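(* Let $n\geq 4$ with $n\equiv 0$ or $1 \pmod 4$. Then the line graph $L(K_n)$ of the complete graph $K_n$ has the PMH--property, i.e. every perfect matching of $L(K_n)$ is contained in some hamiltonian cycle of $L(K_n)$.
   Context: The line graph $L(G)$ has vertex set $E(G)$, two vertices being adjacent when the corresponding edges of $G$ share an end-vertex. A graph has the PMH--property if each of its perfect matchings can be extended to a hamiltonian cycle. *)

theory Defs
  imports Main
begin

record 'a graph =
  verts :: "'a set"
  edges :: "'a set set"

definition simple_graph :: "'a graph \<Rightarrow> bool" where
  "simple_graph G \<longleftrightarrow> (\<forall>e\<in>edges G. e \<subseteq> verts G \<and> card e = 2)"

definition complete_graph :: "nat \<Rightarrow> nat graph" where
  "complete_graph n =
     \<lparr>verts = {..<n}, edges = {e. e \<subseteq> {..<n} \<and> card e = 2}\<rparr>"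

definition line_graph :: "'a graph \<Rightarrow> 'a set graph" where
  "line_graph G =
     \<lparr>verts = edges G,
      edges = {{e, f} | e f. e \<in> edges G \<and> f \<in> edges G \<and> e \<noteq> f \<and> e \<inter> f \<noteq> {}}\<rparr>"

definition matching :: "'a graph \<Rightarrow> 'a set set \<Rightarrow> bool" where
  "matching G M \<longleftrightarrow> M \<subseteq> edges G \<and> pairwise disjnt M"

definition perfect_matching :: "'a graph \<Rightarrow> 'a set set \<Rightarrow> bool" where
  "perfect_matching G M \<longleftrightarrow> matching G M \<and> \<Union>M = verts G"

(* A cycle is given by the list of its vertices in cyclic order; the index i = length vs - 1 in
   cycle_edges yields the closing edge from the last vertex to the first. *)

definition cycle_edges :: "'a list \<Rightarrow> 'a set set" where
  "cycle_edges vs = {{vs ! i, vs ! (Suc i mod length vs)} | i. i < length vs}"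

definition cycle :: "'a graph \<Rightarrow> 'a list \<Rightarrow> bool" where
  "cycle G vs \<longleftrightarrow>
     3 \<le> length vs \<and> distinct vs \<and> set vs \<subseteq> verts G \<and> cycle_edges vs \<subseteq> edges G"

definition hamiltonian_cycle :: "'a graph \<Rightarrow> 'a list \<Rightarrow> bool" where
  "hamiltonian_cycle G vs \<longleftrightarrow> cycle G vs \<and> set vs = verts G"

definition PMH_property :: "'a graph \<Rightarrow> bool" where
  "PMH_property G \<longleftrightarrow>
     (\<forall>M. perfect_matching G M \<longrightarrow> (\<exists>vs. hamiltonian_cycle G vs \<and> M \<subseteq> cycle_edges vs))"

lemma simple_graph_complete_graph: "simple_graph (complete_graph n)"
  by (simp add: simple_graph_def complete_graph_def)

lemma simple_graph_line_graph: "simple_graph (line_graph G)"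
unfolding simple_graph_def
proof
  fix x
  assume "x \<in> edges (line_graph G)"
  then obtain e f where "x = {e, f}" "e \<in> edges G" "f \<in> edges G" "e \<noteq> f"
    unfolding line_graph_def by auto
  then show "x \<subseteq> verts (line_graph G) \<and> card x = 2"
    by (simp add: line_graph_def)
qed

end

theory Submission
  imports Defs "HOL-Combinatorics.Multiset_Permutations"
begin

text \<open>
  A perfect matching \<open>M\<close> of \<open>L(G)\<close> partitions \<open>E(G)\<close> into paths of length two, each with a centre.
  Suppose that a cycle \<open>C\<close> of \<open>G\<close> passes through all these centres and that no path of \<open>M\<close> has both
  its edges on \<open>C\<close>. Walk along \<open>C\<close>; for each edge of \<open>C\<close> list the path of \<open>M\<close> containing it,
  in the order in which one can enter at the tail and leave at the head of that edge, and at
  each vertex list the remaining paths centred there. This is a hamiltonian cycle of \<open>L(G)\<close>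
  containing \<open>M\<close>.

  For \<open>K\<^sub>n\<close> with \<open>n \<ge> 5\<close>, a random hamiltonian cycle contains on average
  \<open>n / (2 * (n - 2)) < 1\<close> paths of \<open>M\<close>, so some hamiltonian cycle contains none. For \<open>n = 4\<close>
  there are three paths, so some vertex \<open>x\<close> is not a centre, and the triangle avoiding \<open>x\<close>
  qualifies: were two of its edges matched, the edge from their common vertex to \<open>x\<close> would have
  to be matched with another edge at \<open>x\<close>.
\<close>

section \<open>Perfect matchings of line graphs\<close>

lemma perfect_matching_line_graph_elem:
  assumes "perfect_matching (line_graph G) M" "p \<in> M"
  obtains e f where "p = {e, f}" "e \<noteq> f" "e \<inter> f \<noteq> {}" "e \<in> edges G" "f \<in> edges G"
proof -
  have "p \<in> edges (line_graph G)"
    using assms by (auto simp: perfect_matching_def matching_def)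
  then show ?thesis
    using that by (auto simp: line_graph_def)
qed

lemma perfect_matching_line_graph_pairD:
  assumes "perfect_matching (line_graph G) M" "{e, f} \<in> M"
  shows "e \<noteq> f" "e \<inter> f \<noteq> {}" "e \<in> edges G" "f \<in> edges G"
proof -
  obtain e' f' where "{e, f} = {e', f'}" "e' \<noteq> f'" "e' \<inter> f' \<noteq> {}" "e' \<in> edges G" "f' \<in> edges G"
    using perfect_matching_line_graph_elem[OF assms] .
  then show "e \<noteq> f" "e \<inter> f \<noteq> {}" "e \<in> edges G" "f \<in> edges G"
    by (auto simp: doubleton_eq_iff)
qed

lemma Union_perfect_matching_line_graph:
  "perfect_matching (line_graph G) M \<Longrightarrow> \<Union>M = edges G"
  by (simp add: perfect_matching_def line_graph_def)

lemma perfect_matching_unique: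
  assumes "perfect_matching H M" "p \<in> M" "q \<in> M" "x \<in> p" "x \<in> q"
  shows "p = q"
  using assms unfolding perfect_matching_def matching_def pairwise_def disjnt_def by blast

lemma perfect_matching_partner:
  assumes "perfect_matching (line_graph G) M" "e \<in> edges G"
  obtains f where "{e, f} \<in> M"
proof -
  obtain p where p: "p \<in> M" "e \<in> p"
    using assms Union_perfect_matching_line_graph by blast
  obtain e' f' where "p = {e', f'}"
    using perfect_matching_line_graph_elem[OF assms(1) p(1)] .
  with p that show ?thesis
    by (metis empty_iff insert_commute insert_iff)
qed

lemma perfect_matching_partner_unique:
  assumes "perfect_matching H M" "{e, f} \<in> M" "{e, f'} \<in> M"
  shows "f = f'"
  using perfect_matching_unique[OF assms, of e] by (auto simp: doubleton_eq_iff)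

section \<open>Tours through matched pairs\<close>

text \<open>An entry \<open>(u, e, f)\<close> of a tour stands for entering the edge \<open>e\<close> at \<open>u\<close>, continuing with its
  partner \<open>f\<close>, and leaving \<open>f\<close> at the first component of the cyclically next entry.\<close>

definition link :: "'a \<times> 'a set \<times> 'a set \<Rightarrow> 'a \<times> 'a set \<times> 'a set \<Rightarrow> bool" where
  "link s t \<longleftrightarrow> fst s \<in> fst (snd s) \<and> fst t \<in> snd (snd s)"

definition pair_of :: "'a \<times> 'a set \<times> 'a set \<Rightarrow> 'a set set" where
  "pair_of t = {fst (snd t), snd (snd t)}"

definition tour :: "('a \<times> 'a set \<times> 'a set) list \<Rightarrow> bool" where
  "tour ts \<longleftrightarrow> ts \<noteq> [] \<and> successively link (ts @ [hd ts])"

text \<open>The new entry enters and leaves at \<open>c\<close>, so whatever links to the old entry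
  also links to the new one, and the new one links to the old. If \<open>A\<close> is empty the head
  changes, but its first component is still \<open>c\<close>, which is all that the closing link
  sees.\<close>

lemma tour_insert:
  assumes "tour (A @ (c, e', f') # B)" "c \<in> e" "c \<in> f"
  shows "tour (A @ (c, e, f) # (c, e', f') # B)"
  using assms by (cases A; cases B)
    (auto simp: tour_def link_def successively_append_iff successively_Cons hd_append)

text \<open>The pairs of \<open>F\<close> are inserted one at a time, each in front of an entry that
  starts at its common vertex. No first component is ever lost, so such an entry remains available
  for the next pair.\<close>

lemma tour_insert_pairs:
  assumes "finite F" "tour ts" "distinct (map pair_of ts)"
    and "F \<inter> pair_of ` set ts = {}"
    and "\<And>p. p \<in> F \<Longrightarrow> \<exists>e f c. p = {e, f} \<and> c \<in> e \<and> c \<in> f \<and> c \<in> fst ` set ts"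
  shows "\<exists>ts'. tour ts' \<and> distinct (map pair_of ts') \<and> pair_of ` set ts' = pair_of ` set ts \<union> F
    \<and> fst ` set ts \<subseteq> fst ` set ts'"
  using assms(1,4,5)
proof (induction F)
  case empty
  with assms show ?case by auto
next
  case (insert p F)
  then obtain ts' where ts': "tour ts'" "distinct (map pair_of ts')"
    "pair_of ` set ts' = pair_of ` set ts \<union> F" "fst ` set ts \<subseteq> fst ` set ts'"
    by auto
  obtain e f c where p: "p = {e, f}" "c \<in> e" "c \<in> f" "c \<in> fst ` set ts"
    using insert.prems(2)[of p] by blast
  with ts'(4) have "c \<in> fst ` set ts'"
    by blast
  then obtain e' f' where "(c, e', f') \<in> set ts'"
    by (metis imageE prod.collapse)
  then obtain A B where AB: "ts' = A @ (c, e', f') # B"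
    by (meson split_list)
  have new: "p \<notin> pair_of ` set ts'"
    using insert ts'(3) by auto
  have pp: "pair_of (c, e, f) = p"
    by (simp add: pair_of_def p)
  let ?ts = "A @ (c, e, f) # (c, e', f') # B"
  have "tour ?ts"
    using tour_insert[OF ts'(1)[unfolded AB] p(2,3)] .
  moreover have "distinct (map pair_of ?ts)"
    using ts'(2) new pp unfolding AB by auto
  moreover have "pair_of ` set ?ts = insert p (pair_of ` set ts')"
    unfolding AB using pp by auto
  moreover have "fst ` set ts \<subseteq> fst ` set ?ts"
    using ts'(4) unfolding AB by auto
  ultimately show ?case
    using ts'(3) by (intro exI[of _ ?ts]) auto
qed

section \<open>From a tour to a hamiltonian cycle of the line graph\<close>

definition edge_list :: "('a \<times> 'a set \<times> 'a set) list \<Rightarrow> 'a set list" where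
  "edge_list ts = concat (map (\<lambda>t. [fst (snd t), snd (snd t)]) ts)"

lemma edge_list_simps [simp]:
  "edge_list [] = []"
  "edge_list (t # ts) = fst (snd t) # snd (snd t) # edge_list ts"
  "edge_list (ts @ ts') = edge_list ts @ edge_list ts'"
  by (simp_all add: edge_list_def)

lemma set_edge_list: "set (edge_list ts) = \<Union>(pair_of ` set ts)"
  by (auto simp: edge_list_def pair_of_def)

lemma length_edge_list: "length (edge_list ts) = 2 * length ts"
  by (induction ts) auto

text \<open>Disjointness of the pairs separates edges of different entries; the last hypothesis
  separates the two edges within one entry.\<close>

lemma distinct_edge_list:
  assumes "distinct (map pair_of ts)" "pairwise disjnt (pair_of ` set ts)"
    and "\<And>u e f. (u, e, f) \<in> set ts \<Longrightarrow> e \<noteq> f"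
  shows "distinct (edge_list ts)"
  using assms
proof (induction ts)
  case (Cons t ts)
  obtain u e f where t: "t = (u, e, f)" by (cases t)
  have "distinct (edge_list ts)"
    using Cons by (auto simp: pairwise_insert)
  moreover have "disjnt (pair_of t) (pair_of s)" if "s \<in> set ts" for s
    using Cons.prems(1,2) that by (auto simp: pairwise_insert)
  then have "pair_of t \<inter> set (edge_list ts) = {}"
    by (auto simp: set_edge_list disjnt_def)
  ultimately show ?case
    using Cons.prems(3)[of u e f] by (auto simp: t pair_of_def)
qed simp

text \<open>Where one entry ends and the next begins, the common vertex is the first component of
  the later entry: it lies on the second edge of the earlier entry and on the first edge of its own.
  The extra entry \<open>t\<close> stands for the return to the head of a closed tour.\<close>

lemma successively_edge_list:
  assumes "successively link (ts @ [t])" "fst t \<in> fst (snd t)"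
    and "\<And>u e f. (u, e, f) \<in> set ts \<Longrightarrow> e \<inter> f \<noteq> {}"
  shows "successively (\<lambda>e f. e \<inter> f \<noteq> {}) (edge_list ts @ [fst (snd t)])"
  using assms
proof (induction ts)
  case (Cons s ts)
  have link: "link s (hd (ts @ [t]))" "successively link (ts @ [t])"
    using Cons.prems(1) by (simp_all add: successively_Cons)
  have "snd (snd s) \<inter> hd (edge_list ts @ [fst (snd t)]) \<noteq> {}"
  proof (cases ts)
    case Nil
    with link(1) Cons.prems(2) show ?thesis by (auto simp: link_def)
  next
    case (Cons r rs)
    with link have "fst r \<in> snd (snd s)" "fst r \<in> fst (snd r)"
      by (auto simp: link_def successively_Cons)
    with Cons show ?thesis by auto
  qed
  moreover have "fst (snd s) \<inter> snd (snd s) \<noteq> {}"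
    using Cons.prems(3)[of "fst s" "fst (snd s)" "snd (snd s)"] by simp
  moreover have "successively (\<lambda>e f. e \<inter> f \<noteq> {}) (edge_list ts @ [fst (snd t)])"
    using Cons.IH[OF link(2) Cons.prems(2)] Cons.prems(3) by (meson list.set_intros(2))
  ultimately show ?case
    by (simp add: successively_Cons)
qed simp

lemma successively_cyclicD:
  assumes "successively R (xs @ [hd xs])" "i < length xs"
  shows "R (xs ! i) (xs ! (Suc i mod length xs))"
proof -
  have "R ((xs @ [hd xs]) ! i) ((xs @ [hd xs]) ! Suc i)"
    using assms by (simp add: successively_conv_nth)
  moreover have "(xs @ [hd xs]) ! Suc i = xs ! (Suc i mod length xs)"
  proof (cases "Suc i = length xs")
    case True
    then show ?thesis using assms(2) by (simp add: nth_append hd_conv_nth flip: length_greater_0_conv)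
  next
    case False
    then show ?thesis using assms(2) by (simp add: nth_append)
  qed
  ultimately show ?thesis
    using assms(2) by (simp add: nth_append)
qed

lemma successively_cyclicI:
  assumes "\<And>i. i < n \<Longrightarrow> R (t i) (t (Suc i mod n))" "n > 0"
  shows "successively R (map t [0..<n] @ [hd (map t [0..<n])])"
proof -
  have "(map t [0..<n] @ [hd (map t [0..<n])]) ! i = t (i mod n)" if "i \<le> n" for i
    using that assms(2) by (cases "i = n") (auto simp: nth_append hd_conv_nth)
  then show ?thesis
    using assms by (auto simp: successively_conv_nth)
qed

text \<open>The edges of the entries, listed in order, exhaust the edges of \<open>G\<close> because
  \<open>M\<close> is perfect. Two entries already give four edges, enough for a cycle.\<close>

lemma tour_imp_hamiltonian_cycle:
  assumes M: "perfect_matching (line_graph G) M"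
    and ts: "tour ts" "distinct (map pair_of ts)" "pair_of ` set ts = M"
    and len: "length ts \<ge> 2"
  shows "\<exists>vs. hamiltonian_cycle (line_graph G) vs \<and> M \<subseteq> cycle_edges vs"
proof (intro exI conjI)
  let ?vs = "edge_list ts"
  have elem: "e \<noteq> f \<and> e \<inter> f \<noteq> {}" if "(u, e, f) \<in> set ts" for u e f
  proof -
    have "{e, f} \<in> M"
      using ts(3) imageI[OF that, of pair_of] by (simp add: pair_of_def)
    then show ?thesis
      using perfect_matching_line_graph_pairD[OF M] by blast
  qed
  have dist: "distinct ?vs"
    using ts M elem by (intro distinct_edge_list) (auto simp: perfect_matching_def matching_def)
  have set: "set ?vs = edges G"
    using set_edge_list[of ts] ts(3) Union_perfect_matching_line_graph[OF M] by simp
  have hd: "hd ?vs = fst (snd (hd ts))"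
    using len by (cases ts) auto
  have "fst (hd ts) \<in> fst (snd (hd ts))"
    using ts(1) by (cases ts) (auto simp: tour_def link_def successively_Cons)
  then have succ: "successively (\<lambda>e f. e \<inter> f \<noteq> {}) (?vs @ [hd ?vs])"
    using ts(1) elem unfolding hd tour_def by (intro successively_edge_list) auto
  have "cycle_edges ?vs \<subseteq> edges (line_graph G)"
  proof
    fix p assume "p \<in> cycle_edges ?vs"
    then obtain i where i: "i < length ?vs" "p = {?vs ! i, ?vs ! (Suc i mod length ?vs)}"
      by (auto simp: cycle_edges_def)
    have j: "Suc i mod length ?vs < length ?vs"
      using i by (intro mod_less_divisor) linarith
    have "i \<noteq> Suc i mod length ?vs"
      using len i(1) by (auto simp: length_edge_list mod_Suc split: if_splits)
    then have "?vs ! i \<noteq> ?vs ! (Suc i mod length ?vs)"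
      using dist i(1) j nth_eq_iff_index_eq by blast
    moreover have "?vs ! i \<in> edges G" "?vs ! (Suc i mod length ?vs) \<in> edges G"
      using set i(1) j by (metis nth_mem)+
    ultimately show "p \<in> edges (line_graph G)"
      using successively_cyclicD[OF succ i(1)] i(2) by (auto simp: line_graph_def)
  qed
  then show "hamiltonian_cycle (line_graph G) ?vs"
    using dist set len
    by (auto simp: hamiltonian_cycle_def cycle_def length_edge_list line_graph_def)
  show "M \<subseteq> cycle_edges ?vs"
  proof
    fix p assume "p \<in> M"
    then obtain t where t: "t \<in> set ts" "p = pair_of t"
      using ts(3) by blast
    then obtain A B where "ts = A @ t # B"
      by (meson split_list)
    then have vs: "?vs = edge_list A @ fst (snd t) # snd (snd t) # edge_list B"
      by simp
    \<comment> \<open>The index is the position of the first edge of \<open>t\<close>; its partner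
      comes next in the list, so there is no wrap-around.\<close>
    show "p \<in> cycle_edges ?vs"
      unfolding cycle_edges_def
      by (rule CollectI, rule exI[of _ "length (edge_list A)"])
         (simp add: vs t pair_of_def nth_append)
  qed
qed

section \<open>From a compatible cycle to a tour\<close>

lemma cycle_edge_index_unique:
  assumes "distinct vs" "3 \<le> length vs" "i < length vs" "j < length vs"
    and "{vs ! i, vs ! (Suc i mod length vs)} = {vs ! j, vs ! (Suc j mod length vs)}"
  shows "i = j"
proof (rule ccontr)
  assume "i \<noteq> j"
  have lt: "Suc k mod length vs < length vs" for k
    using assms(2) by (intro mod_less_divisor) linarith
  have eq: "vs ! k = vs ! l \<longleftrightarrow> k = l" if "k < length vs" "l < length vs" for k l
    using nth_eq_iff_index_eq[OF assms(1)] that .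
  \<comment> \<open>Each index is the cyclic successor of the other, which is possible only on two
    positions.\<close>
  have "i = Suc j mod length vs" "j = Suc i mod length vs"
    using assms(5) \<open>i \<noteq> j\<close> assms(3,4) lt eq by (auto simp: doubleton_eq_iff)
  moreover have "Suc k mod length vs = (if Suc k = length vs then 0 else Suc k)"
    if "k < length vs" for k
    using that by (simp add: mod_Suc)
  ultimately show False
    using assms(2-4) by (simp split: if_splits)
qed

text \<open>Each edge of \<open>S\<close> contributes the pair containing it. By
  \<open>compat\<close> different edges contribute different pairs, and by \<open>centre\<close>
  every remaining pair can be inserted at a vertex of \<open>S\<close>.\<close>

lemma hamiltonian_cycle_if_compatible_cycle:
  assumes M: "perfect_matching (line_graph G) M" and "finite (edges G)"
    and S: "cycle G S"
    and compat: "\<And>e f. e \<in> cycle_edges S \<Longrightarrow> f \<in> cycle_edges S \<Longrightarrow> {e, f} \<notin> M"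
    and centre: "\<And>e f. {e, f} \<in> M \<Longrightarrow> e \<inter> f \<inter> set S \<noteq> {}"
  shows "\<exists>vs. hamiltonian_cycle (line_graph G) vs \<and> M \<subseteq> cycle_edges vs"
proof -
  let ?n = "length S"
  let ?next = "\<lambda>i. Suc i mod ?n"
  let ?g = "\<lambda>i. {S ! i, S ! ?next i}"
  have n: "3 \<le> ?n" and dist: "distinct S" and edge: "cycle_edges S \<subseteq> edges G"
    using S by (auto simp: cycle_def)
  have g: "?g i \<in> cycle_edges S" if "i < ?n" for i
    using that by (auto simp: cycle_edges_def)
  have "\<exists>e f. {e, f} \<in> M \<and> ?g i \<in> {e, f} \<and> S ! i \<in> e \<and> S ! ?next i \<in> f" if i: "i < ?n" for i
  proof -
    obtain h where h: "{?g i, h} \<in> M"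
      using perfect_matching_partner[OF M] edge g[OF i] by blast
    \<comment> \<open>The end at which \<open>h\<close> meets the cycle edge decides the order: at
      the tail \<open>h\<close> is traversed first, at the head it is traversed second.\<close>
    then consider "S ! i \<in> h" | "S ! ?next i \<in> h"
      using perfect_matching_line_graph_pairD(2)[OF M h] by auto
    then show ?thesis
    proof cases
      case 1
      with h show ?thesis
        by (intro exI[of _ h] exI[of _ "?g i"]) (auto simp: insert_commute)
    next
      case 2
      with h show ?thesis
        by (intro exI[of _ h] exI[of _ "?g i"]) (auto simp: insert_commute)
    qed
  qed
  then obtain e f where ef: "\<And>i. i < ?n \<Longrightarrow>
      {e i, f i} \<in> M \<and> ?g i \<in> {e i, f i} \<and> S ! i \<in> e i \<and> S ! ?next i \<in> f i"
    by metis
  define t where "t i = (S ! i, e i, f i)" for i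
  define ts where "ts = map t [0..<?n]"
  have tour: "tour ts"
    unfolding tour_def ts_def
    using n ef by (intro conjI successively_cyclicI) (auto simp: link_def t_def)
  have "pair_of (t i) \<noteq> pair_of (t j)" if "i < ?n" "j < ?n" "i \<noteq> j" for i j
  proof
    assume "pair_of (t i) = pair_of (t j)"
    then have eq: "{e i, f i} = {e j, f j}"
      by (simp add: pair_of_def t_def)
    have "?g i \<noteq> ?g j"
      using cycle_edge_index_unique[OF dist n that(1,2)] that(3) by blast
    moreover have "?g i \<in> {e i, f i}" "?g j \<in> {e i, f i}"
      using ef[OF that(1)] ef[OF that(2)] unfolding eq by blast+
    \<comment> \<open>Two different cycle edges lying in one pair make up the whole pair, against
      \<open>compat\<close>.\<close>
    moreover have "{a, b} = {c, d}" if "a \<noteq> b" "a \<in> {c, d}" "b \<in> {c, d}" for a b c d :: "'a set"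
      using that by auto
    ultimately have "{?g i, ?g j} = {e i, f i}"
      by blast
    with compat[OF g[OF that(1)] g[OF that(2)]] ef[OF that(1)] show False
      by simp
  qed
  then have "inj_on (\<lambda>i. pair_of (t i)) {..<?n}"
    by (meson inj_onI lessThan_iff)
  then have dp: "distinct (map pair_of ts)"
    by (simp add: ts_def distinct_map comp_def atLeast0LessThan)
  have sub: "pair_of ` set ts \<subseteq> M"
    using ef by (auto simp: ts_def t_def pair_of_def)
  have visit: "fst ` set ts = set S"
  proof -
    have "fst ` set ts = (\<lambda>i. S ! i) ` {..<?n}"
      by (simp add: ts_def t_def image_image atLeast0LessThan)
    then show ?thesis
      by (auto simp: set_conv_nth)
  qed
  have "finite M"
    using finite_UnionD[of M] assms(2) Union_perfect_matching_line_graph[OF M] by simp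
  moreover have "\<exists>e f c. p = {e, f} \<and> c \<in> e \<and> c \<in> f \<and> c \<in> fst ` set ts" if p: "p \<in> M" for p
  proof -
    obtain e f where "p = {e, f}"
      using perfect_matching_line_graph_elem[OF M p] .
    with centre[of e f] p show ?thesis
      unfolding visit by blast
  qed
  ultimately obtain ts' where ts': "tour ts'" "distinct (map pair_of ts')"
      "pair_of ` set ts' = pair_of ` set ts \<union> (M - pair_of ` set ts)"
      "fst ` set ts \<subseteq> fst ` set ts'"
    using tour_insert_pairs[OF _ tour dp, of "M - pair_of ` set ts"]
    by (metis Diff_disjoint Int_commute DiffD1 finite_Diff)
  \<comment> \<open>Different starting vertices need different entries, so the tour is long enough
    to yield a cycle.\<close>
  have "3 \<le> card (fst ` set ts)"
    using n dist by (simp add: visit distinct_card)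
  also have "\<dots> \<le> card (fst ` set ts')"
    using ts'(4) by (intro card_mono) auto
  also have "\<dots> \<le> length ts'"
    using card_image_le[of "set ts'" fst] card_length[of ts'] by simp
  finally show ?thesis
    using tour_imp_hamiltonian_cycle[OF M ts'(1,2)] ts'(3) sub by (simp add: Un_absorb1)
qed

section \<open>Compatible cycles in complete graphs\<close>

lemma edges_complete_graph: "edges (complete_graph n) = {e. e \<subseteq> {..<n} \<and> card e = 2}"
  by (simp add: complete_graph_def)

lemma pair_in_edges_complete_graph:
  "{a, b} \<in> edges (complete_graph n) \<longleftrightarrow> a < n \<and> b < n \<and> a \<noteq> b"
  by (auto simp: edges_complete_graph card_insert_if)

lemma card_edges_complete_graph: "card (edges (complete_graph n)) = n choose 2"
  using n_subsets[of "{..<n}" 2] by (simp add: edges_complete_graph)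

lemma finite_edges_complete_graph: "finite (edges (complete_graph n))"
  by (rule finite_subset[of _ "Pow {..<n}"]) (auto simp: edges_complete_graph)

lemma cycle_complete_graph:
  assumes "distinct S" "3 \<le> length S" "set S \<subseteq> {..<n}"
  shows "cycle (complete_graph n) S"
  unfolding cycle_def
proof (intro conjI subsetI)
  fix e assume "e \<in> cycle_edges S"
  then obtain i where i: "i < length S" "e = {S ! i, S ! (Suc i mod length S)}"
    by (auto simp: cycle_edges_def)
  have j: "Suc i mod length S < length S"
    using i by (intro mod_less_divisor) linarith
  have "i \<noteq> Suc i mod length S"
    using assms(2) i(1) by (auto simp: mod_Suc split: if_splits)
  then have "S ! i \<noteq> S ! (Suc i mod length S)"
    using assms(1) i(1) j nth_eq_iff_index_eq by blast
  moreover have "S ! i < n" "S ! (Suc i mod length S) < n"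
    using assms(3) i(1) j by (meson lessThan_iff nth_mem subsetD)+
  ultimately show "e \<in> edges (complete_graph n)"
    by (simp add: i pair_in_edges_complete_graph)
qed (use assms in \<open>auto simp: complete_graph_def\<close>)

text \<open>There are at most as many ordered paths in \<open>M\<close> as edges, because the first edge
  determines its partner and hence the common vertex.\<close>

definition matched_paths :: "'a set set set \<Rightarrow> ('a \<times> 'a \<times> 'a) set" where
  "matched_paths M = {(a, c, b). {{a, c}, {c, b}} \<in> M}"

lemma matched_paths_distinct:
  assumes "perfect_matching (line_graph (complete_graph n)) M" "(a, c, b) \<in> matched_paths M"
  shows "a < n" "b < n" "c < n" "a \<noteq> c" "c \<noteq> b" "a \<noteq> b"
proof -
  have p: "{{a, c}, {c, b}} \<in> M"
    using assms(2) by (simp add: matched_paths_def)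
  show "a < n" "b < n" "c < n" "a \<noteq> c" "c \<noteq> b"
    using perfect_matching_line_graph_pairD(3,4)[OF assms(1) p]
    by (auto simp: pair_in_edges_complete_graph)
  show "a \<noteq> b"
    using perfect_matching_line_graph_pairD(1)[OF assms(1) p] by (auto simp: insert_commute)
qed

lemma card_matched_paths_le:
  assumes M: "perfect_matching (line_graph (complete_graph n)) M"
  shows "finite (matched_paths M)" "card (matched_paths M) \<le> n choose 2"
proof -
  let ?h = "\<lambda>(a, c, b). {a, c}"
  have inj: "inj_on ?h (matched_paths M)"
  proof (rule inj_onI)
    fix s t assume st: "s \<in> matched_paths M" "t \<in> matched_paths M" "?h s = ?h t"
    obtain a c b a' c' b' where eq: "s = (a, c, b)" "t = (a', c', b')"
      by (cases s; cases t) auto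
    then have *: "(a, c, b) \<in> matched_paths M" "(a', c', b') \<in> matched_paths M"
        "{a, c} = {a', c'}"
      using st by simp_all
    then have "{c, b} = {c', b'}"
      using perfect_matching_partner_unique[OF M, of "{a, c}"] by (simp add: matched_paths_def)
    then show "s = t"
      unfolding eq using * matched_paths_distinct[OF M *(1)] matched_paths_distinct[OF M *(2)]
      by (auto simp: doubleton_eq_iff)
  qed
  have sub: "?h ` matched_paths M \<subseteq> edges (complete_graph n)"
    using matched_paths_distinct[OF M] by (auto simp: pair_in_edges_complete_graph)
  show "finite (matched_paths M)"
    using inj_on_finite[OF inj sub finite_edges_complete_graph] .
  show "card (matched_paths M) \<le> n choose 2"
    using card_inj_on_le[OF inj sub finite_edges_complete_graph]
    by (simp add: card_edges_complete_graph)
qed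

section \<open>Counting permutations that begin with a matched path\<close>

definition starts_matched :: "'a set set set \<Rightarrow> 'a list \<Rightarrow> bool" where
  "starts_matched M l \<longleftrightarrow> (l ! 0, l ! 1, l ! 2) \<in> matched_paths M"

text \<open>Such a permutation is an ordered matched path followed by an arrangement of the other
  \<open>n - 3\<close> vertices.\<close>

lemma card_starts_matched_le:
  assumes M: "perfect_matching (line_graph (complete_graph n)) M" and "3 \<le> n"
  shows "card {l \<in> permutations_of_set {..<n}. starts_matched M l} \<le> (n choose 2) * fact (n - 3)"
proof -
  let ?A = "{..<n}"
  let ?F = "\<lambda>(a, c, b). (\<lambda>l. a # c # b # l) ` permutations_of_set (?A - {a, c, b})"
  have "{l \<in> permutations_of_set ?A. starts_matched M l} \<subseteq> (\<Union>x\<in>matched_paths M. ?F x)"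
  proof
    fix l assume l: "l \<in> {l \<in> permutations_of_set ?A. starts_matched M l}"
    then have "length l = n"
      using length_finite_permutations_of_set[of l ?A] by simp
    then obtain a c b l' where l': "l = a # c # b # l'"
      using \<open>3 \<le> n\<close> by (metis Suc_le_length_iff numeral_3_eq_3)
    then have "l' \<in> permutations_of_set (?A - {a, c, b})"
      using l by (auto simp: permutations_of_set_def)
    moreover have "(a, c, b) \<in> matched_paths M"
      using l by (simp add: l' starts_matched_def numeral_2_eq_2)
    ultimately show "l \<in> (\<Union>x\<in>matched_paths M. ?F x)"
      using l' by auto
  qed
  then have "card {l \<in> permutations_of_set ?A. starts_matched M l}
      \<le> card (\<Union>x\<in>matched_paths M. ?F x)"
    using card_matched_paths_le(1)[OF M] by (intro card_mono) auto
  also have "\<dots> \<le> (\<Sum>x\<in>matched_paths M. card (?F x))"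
    by (rule card_UN_le[OF card_matched_paths_le(1)[OF M]])
  also have "\<dots> = (\<Sum>x\<in>matched_paths M. fact (n - 3))"
  proof (rule sum.cong[OF refl])
    fix x assume x: "x \<in> matched_paths M"
    obtain a c b where abc: "x = (a, c, b)" by (cases x)
    note d = matched_paths_distinct[OF M x[unfolded abc]]
    have "card (?A - {a, c, b}) = n - 3"
      using d by (subst card_Diff_subset) auto
    then show "card (?F x) = fact (n - 3)"
      by (simp add: abc card_image inj_on_def)
  qed
  also have "\<dots> \<le> (n choose 2) * fact (n - 3)"
    using card_matched_paths_le(2)[OF M] by simp
  finally show ?thesis .
qed

text \<open>Union bound over the \<open>n\<close> rotations, which bring each position of the cyclic
  order to the front.\<close>

lemma exists_unmatched_permutation:
  assumes M: "perfect_matching (line_graph (complete_graph n)) M" and "5 \<le> n"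
  obtains l where "l \<in> permutations_of_set {..<n}"
    "\<And>i. i < n \<Longrightarrow> \<not> starts_matched M (rotate i l)"
proof -
  let ?P = "permutations_of_set {..<n}"
  let ?B = "\<lambda>i. {l \<in> ?P. starts_matched M (rotate i l)}"
  have "card (?B i) \<le> (n choose 2) * fact (n - 3)" for i
  proof -
    \<comment> \<open>Rotation is injective on permutations, so every position is bad equally rarely
      as the first one.\<close>
    have "card (?B i) \<le> card {l \<in> ?P. starts_matched M l}"
    proof (rule card_inj_on_le)
      show "inj_on (rotate i) (?B i)"
        unfolding rotate_def by (rule inj_on_subset[OF inj_fn[OF inj_rotate1]]) simp
      show "rotate i ` ?B i \<subseteq> {l \<in> ?P. starts_matched M l}"
        by (rule image_subsetI) (simp add: permutations_of_set_def)
      show "finite {l \<in> ?P. starts_matched M l}"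
        by (rule finite_subset[of _ ?P]) auto
    qed
    also have "\<dots> \<le> (n choose 2) * fact (n - 3)"
      using card_starts_matched_le[OF M] assms(2) by simp
    finally show ?thesis .
  qed
  then have "(\<Sum>i<n. card (?B i)) \<le> n * ((n choose 2) * fact (n - 3))"
    using sum_bounded_above[of "{..<n}" "\<lambda>i. card (?B i)"] by simp
  then have "card (\<Union>i<n. ?B i) \<le> n * ((n choose 2) * fact (n - 3))"
    using card_UN_le[OF finite_lessThan, of ?B n] by linarith
  also have "\<dots> < fact n"
  proof -
    have "fact n = n * (fact (n - 1) :: nat)" "fact (n - 1) = (n - 1) * (fact (n - 2) :: nat)"
      "fact (n - 2) = (n - 2) * (fact (n - 3) :: nat)"
      using assms(2) fact_reduce[of n, where 'a = nat] fact_reduce[of "n - 1", where 'a = nat]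
        fact_reduce[of "n - 2", where 'a = nat]
      by (simp_all add: numeral_2_eq_2 numeral_3_eq_3)
    then have fact: "fact n = n * ((n - 1) * (n - 2) * (fact (n - 3) :: nat))"
      by simp
    \<comment> \<open>This amounts to \<open>n < 2 * (n - 2)\<close>, that is \<open>n > 4\<close>;
      for four vertices the union bound is exactly \<open>fact 4\<close> and gives nothing.\<close>
    have "n * (n - 1) < 2 * (n - 2) * (n - 1)"
      using assms(2) by (intro mult_strict_right_mono) simp_all
    then have "n choose 2 < (n - 1) * (n - 2)"
      unfolding choose_two by (simp add: less_mult_imp_div_less mult.commute mult.left_commute)
    then have "(n choose 2) * fact (n - 3) < (n - 1) * (n - 2) * (fact (n - 3) :: nat)"
      by (intro mult_strict_right_mono) simp_all
    then show ?thesis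
      using assms(2) unfolding fact by (intro mult_strict_left_mono) simp_all
  qed
  also have "fact n = card ?P"
    by simp
  finally have "\<not> ?P \<subseteq> (\<Union>i<n. ?B i)"
    using card_mono[of "\<Union>i<n. ?B i" ?P] by auto
  then show ?thesis
    using that by auto
qed

lemma exists_hamiltonian_cycle_line_graph_complete_graph:
  assumes M: "perfect_matching (line_graph (complete_graph n)) M" and "5 \<le> n"
  shows "\<exists>vs. hamiltonian_cycle (line_graph (complete_graph n)) vs \<and> M \<subseteq> cycle_edges vs"
proof -
  obtain S where S: "S \<in> permutations_of_set {..<n}"
    and un: "\<And>i. i < n \<Longrightarrow> \<not> starts_matched M (rotate i S)"
    using exists_unmatched_permutation[OF assms] by blast
  have len: "length S = n" and dist: "distinct S" and set: "set S = {..<n}"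
    using S by (auto simp: length_finite_permutations_of_set permutations_of_set_def)
  let ?next = "\<lambda>i. Suc i mod n"
  have lt: "?next i < n" for i
    using assms(2) by simp
  have step: "{{S ! i, S ! ?next i}, {S ! ?next i, S ! ?next (?next i)}} \<notin> M" if "i < n" for i
    using un[OF that] assms(2) that
    by (simp add: starts_matched_def matched_paths_def nth_rotate len mod_simps)
  have "{e, f} \<notin> M" if cyc: "e \<in> cycle_edges S" "f \<in> cycle_edges S" for e f
  proof
    assume ef: "{e, f} \<in> M"
    obtain i j where i: "i < n" "e = {S ! i, S ! ?next i}" and j: "j < n" "f = {S ! j, S ! ?next j}"
      using cyc by (auto simp: cycle_edges_def len)
    have "i \<noteq> j"
      using perfect_matching_line_graph_pairD(1)[OF M ef] i j by auto
    moreover have "?next i \<noteq> ?next j"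
      using calculation i j by (auto simp: mod_Suc split: if_splits)
    moreover have "S ! k = S ! l \<longleftrightarrow> k = l" if "k < n" "l < n" for k l
      using nth_eq_iff_index_eq[OF dist] that len by simp
    \<comment> \<open>Matched edges share a vertex; as their tails differ and their heads differ,
      the head of one is the tail of the other. They are thus consecutive on \<open>S\<close>, which
      \<open>step\<close> excludes.\<close>
    ultimately have "j = ?next i \<or> i = ?next j"
      using perfect_matching_line_graph_pairD(2)[OF M ef] i j lt by auto
    then show False
      using step[OF i(1)] step[OF j(1)] ef i(2) j(2) by (auto simp: insert_commute)
  qed
  moreover have "e \<inter> f \<inter> set S \<noteq> {}" if "{e, f} \<in> M" for e f
    using perfect_matching_line_graph_pairD(2,3)[OF M that] set
    by (auto simp: edges_complete_graph)
  moreover have "cycle (complete_graph n) S"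
    using dist len set assms(2) by (intro cycle_complete_graph) auto
  ultimately show ?thesis
    using hamiltonian_cycle_if_compatible_cycle[OF M finite_edges_complete_graph] by blast
qed

section \<open>The case of four vertices\<close>

lemma exists_hamiltonian_cycle_line_graph_complete_graph_4:
  assumes M: "perfect_matching (line_graph (complete_graph 4)) M"
  shows "\<exists>vs. hamiltonian_cycle (line_graph (complete_graph 4)) vs \<and> M \<subseteq> cycle_edges vs"
proof -
  let ?E = "edges (complete_graph 4)"
  have "finite M"
    using finite_UnionD[of M] finite_edges_complete_graph[of 4]
      Union_perfect_matching_line_graph[OF M] by simp
  have "2 * card M = card (\<Union>M)"
  proof (rule card_partition)
    show "finite M" by fact
    show "finite (\<Union>M)"
      using finite_edges_complete_graph[of 4] Union_perfect_matching_line_graph[OF M] by simp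
    show "card p = 2" if p: "p \<in> M" for p
      using perfect_matching_line_graph_elem[OF M p] by (metis card_2_iff)
    show "p \<inter> q = {}" if "p \<in> M" "q \<in> M" "p \<noteq> q" for p q
      using perfect_matching_unique[OF M that(1,2)] that(3) by blast
  qed
  also have "\<dots> = 6"
    using Union_perfect_matching_line_graph[OF M] card_edges_complete_graph[of 4]
    by (simp add: choose_two)
  finally have "card M = 3" by simp
  \<comment> \<open>Quantifying over both orders of the pair makes the centre a function
    \<open>z\<close> of the unordered pair.\<close>
  have "\<exists>c. \<forall>e f. p = {e, f} \<longrightarrow> e \<inter> f = {c}" if p: "p \<in> M" for p
  proof -
    obtain e f where ef: "p = {e, f}" "e \<noteq> f" "e \<inter> f \<noteq> {}" "e \<in> ?E" "f \<in> ?E"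
      using perfect_matching_line_graph_elem[OF M p] .
    then obtain c a b where "e = {c, a}" "f = {c, b}" "a \<noteq> b" "c \<noteq> a" "c \<noteq> b"
      by (auto simp: edges_complete_graph card_2_iff doubleton_eq_iff)
    then have "e \<inter> f = {c}" by auto
    then show ?thesis
      by (intro exI[of _ c]) (auto simp: ef doubleton_eq_iff Int_commute)
  qed
  then obtain z where z: "\<And>e f. {e, f} \<in> M \<Longrightarrow> e \<inter> f = {z {e, f}}"
    by metis
  have "card (z ` M) \<le> 3"
    using card_image_le[OF \<open>finite M\<close>, of z] \<open>card M = 3\<close> by simp
  then have "\<not> {..<4} \<subseteq> z ` M"
    using card_mono[of "z ` M" "{..<4::nat}"] \<open>finite M\<close> by auto
  then obtain x where x: "x < 4" "x \<notin> z ` M" by auto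
  have x': "x \<notin> e \<inter> f" if "{e, f} \<in> M" for e f
    using z[OF that] x(2) that by blast
  define S where "S = sorted_list_of_set ({..<4} - {x})"
  have S: "distinct S" "length S = 3" "set S = {..<4} - {x}"
    using x(1) by (simp_all add: S_def)
  have "{e, f} \<notin> M" if cyc: "e \<in> cycle_edges S" "f \<in> cycle_edges S" for e f
  proof
    assume ef: "{e, f} \<in> M"
    have sub: "cycle_edges S \<subseteq> ?E"
      using cycle_complete_graph[of S 4] S by (simp add: cycle_def)
    have avoid: "x \<notin> g" if g: "g \<in> cycle_edges S" for g
    proof -
      obtain i where i: "i < length S" "g = {S ! i, S ! (Suc i mod length S)}"
        using g by (auto simp: cycle_edges_def)
      then have "S ! i \<in> set S" "S ! (Suc i mod length S) \<in> set S"
        using S(2) by (auto intro!: nth_mem)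
      then show ?thesis using S(3) i(2) by auto
    qed
    obtain c where c: "c \<in> e" "c \<in> f"
      using z[OF ef] by blast
    have ne: "e \<noteq> f"
      using perfect_matching_line_graph_pairD(1)[OF M ef] .
    have e: "e \<subseteq> {..<4}" "card e = 2" "x \<notin> e" and f: "f \<subseteq> {..<4}" "card f = 2" "x \<notin> f"
      using sub avoid cyc by (auto simp: edges_complete_graph)
    have cx: "c < 4" "c \<noteq> x"
      using c e by auto
    then obtain h where h: "{{c, x}, h} \<in> M"
      using perfect_matching_partner[OF M, of "{c, x}"] x(1)
      by (auto simp: pair_in_edges_complete_graph)
    note hD = perfect_matching_line_graph_pairD[OF M h]
    \<comment> \<open>Otherwise \<open>x\<close> would be the centre of the pair formed by
      \<open>{c, x}\<close> and \<open>h\<close>. Hence \<open>h\<close> passes through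
      \<open>c\<close> and stays within the triangle.\<close>
    have "x \<notin> h"
      using x'[OF h] by simp
    then have "c \<in> h" using hD(2) by auto
    obtain a b d where abd: "e = {c, a}" "f = {c, b}" "h = {c, d}"
      "a \<noteq> c" "b \<noteq> c" "d \<noteq> c" "a < 4" "b < 4" "d < 4" "a \<noteq> x" "b \<noteq> x" "d \<noteq> x"
    proof -
      have other: "\<exists>y. g = {c, y} \<and> y \<noteq> c \<and> y < 4 \<and> y \<noteq> x"
        if "g \<subseteq> {..<4}" "card g = 2" "c \<in> g" "x \<notin> g" for g
        using that by (auto simp: card_2_iff)
      have "h \<subseteq> {..<4}" "card h = 2"
        using hD(4) by (auto simp: edges_complete_graph)
      then show ?thesis
        using that other[OF e(1,2) c(1) e(3)] other[OF f(1,2) c(2) f(3)]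
          other[of h] \<open>x \<notin> h\<close> \<open>c \<in> h\<close> by blast
    qed
    have "a \<noteq> b" using ne abd by auto
    \<comment> \<open>Besides \<open>c\<close> and \<open>x\<close> only two vertices remain, and
      \<open>a\<close> and \<open>b\<close> already take both.\<close>
    have "d = a \<or> d = b"
    proof (rule ccontr)
      assume "\<not> (d = a \<or> d = b)"
      then have "card {a, b, c, d, x} = 5"
        using abd(4-12) \<open>a \<noteq> b\<close> cx by (auto simp: card_insert_if)
      moreover have "card {a, b, c, d, x} \<le> card {..<4::nat}"
        using abd(4-12) cx x(1) by (intro card_mono) auto
      ultimately show False by simp
    qed
    then have "h = e \<or> h = f" using abd by auto
    then have "h \<in> {e, f}" by auto
    \<comment> \<open>Both pairs contain \<open>h\<close>, so they coincide; but neither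
      \<open>e\<close> nor \<open>f\<close> contains \<open>x\<close>.\<close>
    then have "{{c, x}, h} = {e, f}"
      using perfect_matching_unique[OF M h ef, of h] by auto
    then show False
      using e(3) f(3) by (auto simp: doubleton_eq_iff)
  qed
  moreover have "e \<inter> f \<inter> set S \<noteq> {}" if "{e, f} \<in> M" for e f
    using perfect_matching_line_graph_pairD(2,3)[OF M that] x'[OF that] S(3)
    by (auto simp: edges_complete_graph)
  moreover have "cycle (complete_graph 4) S"
    using S by (intro cycle_complete_graph) auto
  ultimately show ?thesis
    using hamiltonian_cycle_if_compatible_cycle[OF M finite_edges_complete_graph] by blast
qed

theorem theorem3:
  fixes n :: nat
  assumes "n \<ge> 4" and "n mod 4 = 0 \<or> n mod 4 = 1"
  shows "PMH_property (line_graph (complete_graph n))"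
  unfolding PMH_property_def
proof (intro allI impI)
  fix M assume M: "perfect_matching (line_graph (complete_graph n)) M"
  show "\<exists>vs. hamiltonian_cycle (line_graph (complete_graph n)) vs \<and> M \<subseteq> cycle_edges vs"
  proof (cases "n = 4")
    case True
    with exists_hamiltonian_cycle_line_graph_complete_graph_4 M show ?thesis by simp
  next
    case False
    with exists_hamiltonian_cycle_line_graph_complete_graph[OF M] assms(1) show ?thesis by simp
  qed
qed

end
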